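(* Let $k\in\mathbb N$, $k\ge 1$, $j=2k-1$. Define $$n_i=M_{2i-2},\qquad U_i=\frac{M_{2i-1}}{M_{2i-2}},\qquad P_i=n_{i+1}-n_iU_i^2,\qquad i=1,\dots,k,$$ where $M_0,M_1,\dots$ are the moments and all even moments appearing in denominators are nonzero. (1) For classical solutions, the moment system closed at step $j=2k-1$ (see context) can be rewritten equivalently in the form of the following $k$ pairs of equations, called (MF), for $i=1,\dots,k$: $$(n_i)_t+(n_iU_i)_x=-(2i-2)\,E\,n_{i-1}U_{i-1},\qquad (n_iU_i)_t+(n_iU_i^2+P_i)_x=-(2i-1)\,E\,n_i,$$ (where for $i=1$ the right-hand side of the first equation is $0$), with $P_k=0$, supplemented by the equation for the electric field $$E_t+U_1E_x=U_1.$$ (2) The closure principle $M_{2k-1}^2=M_{2k}M_{2k-2}$ corresponds to $P_k=0$ at the step $k$. (3) Under the assumption $P_i=0$ for $i>k$, the infinite system of pairs of equations describing the fluids with numbers $i>k$, namely $$(n_i)_t+(n_iU_i)_x=-(2i-2)\,E\,n_{i-1}U_{i-1},\qquad (n_iU_i)_t+(n_iU_i^2+P_i)_x=-(2i-1)\,E\,n_i,\qquad i>k$$ (with $n_i,U_i,P_i$ given by the same formulas in terms of the moments for all $i$), is a consequence of the closure of the system at step $k$.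
   Context: For a phase space distribution function $F(t,x,v)\ge 0$ ($t\ge 0$, $x,v\in\mathbb R$) satisfying the one-dimensional Vlasov-Poisson equations $F_t+vF_x-E(t,x)F_v=0$, $E_x=1-n$, $n(t,x)=\int_{\mathbb R}F\,dv$, the moments $M_i(t,x)=\int_{\mathbb R}v^iF(t,x,v)\,dv$ (assumed to exist for all $i\ge 0$) satisfy the infinite chain $(M_0)_t+(M_1)_x=0$ and $(M_i)_t+(M_{i+1})_x=-iEM_{i-1}$, $i\ge 1$. The closure at step $k$ (that is, at the odd moment index $j=2k-1$) is the assumption that the Hölder inequality $M_{2k-1}^2\le M_{2k}M_{2k-2}$ becomes an equality, $M_{2k-1}^2=M_{2k}M_{2k-2}$, i.e. $M_{j+1}$ is replaced by $M_j^2/M_{j-1}$. The closed moment system at step $j=2k-1$ for $M_0,\dots,M_j$ is $$(M_0)_t+(M_1)_x=0,\qquad (M_i)_t+(M_{i+1})_x=-iEM_{i-1}\quad (1\le i\le j-1),\qquad (M_j)_t+\left(\frac{M_j^2}{M_{j-1}}\right)_x=-jEM_{j-1},$$ where the field $E$ is coupled to the moments through the equation $E_t+U_1E_x=U_1$, $U_1=M_1/M_0$ (with $E_x=1-M_0$ and $E$ assumed zero at infinity). After the closure, the moments of order larger than $j$ are defined by continuing the same principle: $$M_{j+i}=\frac{M_j^{\,i+1}}{M_{j-1}^{\,i}},\qquad i\in\mathbb N.$$ In particular $n_{k+1}=M_{2k}=M_{2k-1}^2/M_{2k-2}$ under the closure. Classical solutions are solutions smooth enough for all the derivatives in the equations to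 exist in the usual sense. Subscripts $t$ and $x$ denote partial derivatives.
   Formalization: In (3) all M_i, including those of order above j given by the closure formula, are assumed to be moments of one nonnegative measure F in v (not necessarily a density); for arbitrary solutions of the closed system with higher moments merely defined by the formula, (3) fails when k≥2. *)

theory Defs
  imports "HOL-Analysis.Analysis"
begin

text \<open>Functions of (t, x), with t ranging over \<^term>\<open>time_dom T\<close> and x over the whole line.\<close>

type_synonym txfun = "real \<Rightarrow> real \<Rightarrow> real"

definition time_dom :: "ereal \<Rightarrow> real set" where
  "time_dom T = {t. 0 \<le> t \<and> ereal t < T}"

text \<open>The equation \<open>q\<^sub>t + f\<^sub>x = g\<close> in the classical sense: existence of the two derivatives is
  part of the equation; the time derivative is one-sided at t = 0.\<close>

definition balance_law :: "ereal \<Rightarrow> txfun \<Rightarrow> txfun \<Rightarrow> txfun \<Rightarrow> bool" where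
  "balance_law T q f g \<longleftrightarrow>
    (\<forall>t\<in>time_dom T. \<forall>x. \<exists>q_t f_x.
       ((\<lambda>s. q s x) has_real_derivative q_t) (at t within time_dom T) \<and>
       ((\<lambda>y. f t y) has_real_derivative f_x) (at x) \<and>
       q_t + f_x = g t x)"

definition field_equation :: "ereal \<Rightarrow> txfun \<Rightarrow> txfun \<Rightarrow> bool" where
  "field_equation T u E \<longleftrightarrow>
    (\<forall>t\<in>time_dom T. \<forall>x. \<exists>E_t E_x.
       ((\<lambda>s. E s x) has_real_derivative E_t) (at t within time_dom T) \<and>
       ((\<lambda>y. E t y) has_real_derivative E_x) (at x) \<and>
       E_t + u t x * E_x = u t x)"

text \<open>The distribution in v is a (nonnegative) Borel measure for each (t, x), a density being the
  special case \<^term>\<open>density lborel f\<close>.  Measures are needed because equality in the Hoelder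
  inequality is attained only by concentrated distributions, such as point masses.\<close>

definition moments_of :: "ereal \<Rightarrow> (real \<Rightarrow> real \<Rightarrow> real measure) \<Rightarrow> (nat \<Rightarrow> txfun) \<Rightarrow> bool" where
  "moments_of T F M \<longleftrightarrow>
    (\<forall>t\<in>time_dom T. \<forall>x. sets (F t x) = sets borel \<and>
       (\<forall>i. integrable (F t x) (\<lambda>v. v ^ i) \<and> M i t x = (\<integral>v. v ^ i \<partial>F t x)))"

definition fluid_n :: "(nat \<Rightarrow> txfun) \<Rightarrow> nat \<Rightarrow> txfun" where
  "fluid_n M i t x = M (2 * i - 2) t x"

definition fluid_U :: "(nat \<Rightarrow> txfun) \<Rightarrow> nat \<Rightarrow> txfun" where
  "fluid_U M i t x = M (2 * i - 1) t x / M (2 * i - 2) t x"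

definition fluid_P :: "(nat \<Rightarrow> txfun) \<Rightarrow> nat \<Rightarrow> txfun" where
  "fluid_P M i t x = fluid_n M (i + 1) t x - fluid_n M i t x * (fluid_U M i t x)\<^sup>2"

definition closure_principle :: "ereal \<Rightarrow> nat \<Rightarrow> (nat \<Rightarrow> txfun) \<Rightarrow> bool" where
  "closure_principle T k M \<longleftrightarrow>
    (\<forall>t\<in>time_dom T. \<forall>x. (M (2 * k - 1) t x)\<^sup>2 = M (2 * k) t x * M (2 * k - 2) t x)"

definition P_vanishes :: "ereal \<Rightarrow> nat \<Rightarrow> (nat \<Rightarrow> txfun) \<Rightarrow> bool" where
  "P_vanishes T i M \<longleftrightarrow> (\<forall>t\<in>time_dom T. \<forall>x. fluid_P M i t x = 0)"

text \<open>A system for \<open>M\<^sub>0, \<dots>, M\<^sub>j\<close> and \<open>E\<close> only; higher moments do not enter.\<close>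

definition closed_moment_system :: "ereal \<Rightarrow> nat \<Rightarrow> (nat \<Rightarrow> txfun) \<Rightarrow> txfun \<Rightarrow> bool" where
  "closed_moment_system T j M E \<longleftrightarrow>
    balance_law T (M 0) (M 1) (\<lambda>t x. 0) \<and>
    (\<forall>i. 1 \<le> i \<and> i \<le> j - 1 \<longrightarrow>
       balance_law T (M i) (M (i + 1)) (\<lambda>t x. - real i * E t x * M (i - 1) t x)) \<and>
    balance_law T (M j) (\<lambda>t x. (M j t x)\<^sup>2 / M (j - 1) t x)
      (\<lambda>t x. - real j * E t x * M (j - 1) t x) \<and>
    field_equation T (\<lambda>t x. M 1 t x / M 0 t x) E"

definition higher_moments_closed :: "ereal \<Rightarrow> nat \<Rightarrow> (nat \<Rightarrow> txfun) \<Rightarrow> bool" where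
  "higher_moments_closed T j M \<longleftrightarrow>
    (\<forall>t\<in>time_dom T. \<forall>x. \<forall>i. M (j + i) t x = M j t x ^ (i + 1) / M (j - 1) t x ^ i)"

definition fluid_pair :: "ereal \<Rightarrow> nat \<Rightarrow> (nat \<Rightarrow> txfun) \<Rightarrow> txfun \<Rightarrow> bool" where
  "fluid_pair T i M E \<longleftrightarrow>
    balance_law T (fluid_n M i) (\<lambda>t x. fluid_n M i t x * fluid_U M i t x)
      (\<lambda>t x. if i = 1 then 0
         else - (2 * real i - 2) * E t x * (fluid_n M (i - 1) t x * fluid_U M (i - 1) t x)) \<and>
    balance_law T (\<lambda>t x. fluid_n M i t x * fluid_U M i t x)
      (\<lambda>t x. fluid_n M i t x * (fluid_U M i t x)\<^sup>2 + fluid_P M i t x)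
      (\<lambda>t x. - (2 * real i - 1) * E t x * fluid_n M i t x)"

definition MF_system :: "ereal \<Rightarrow> nat \<Rightarrow> (nat \<Rightarrow> txfun) \<Rightarrow> txfun \<Rightarrow> bool" where
  "MF_system T k M E \<longleftrightarrow>
    (\<forall>i\<in>{1..k}. fluid_pair T i M E) \<and> P_vanishes T k M \<and>
    field_equation T (fluid_U M 1) E"

end

theory Submission
  imports Defs
begin

text \<open>Since \<open>n\<^sub>i U\<^sub>i = M\<^bsub>2i-1\<^esub>\<close> and \<open>n\<^sub>i U\<^sub>i\<^sup>2 + P\<^sub>i = M\<^bsub>2i\<^esub>\<close>, the \<open>i\<close>-th pair of fluid equations is
  the pair of moment equations with numbers \<open>2i - 2\<close> and \<open>2i - 1\<close>, and \<open>P\<^sub>k = 0\<close> is the closure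
  \<open>M\<^bsub>2k-1\<^esub>\<^sup>2 = M\<^bsub>2k\<^esub> M\<^bsub>2k-2\<^esub>\<close>.  For the fluids above the closure write \<open>a = M\<^bsub>j-1\<^esub>\<close>,
  \<open>b = M\<^bsub>j\<^esub>\<close>, \<open>U = b / a\<close>.  The chain rule expresses the balance of \<open>a U\<^bsup>l+1\<^esup>\<close> through the last two
  closed equations as \<open>(l + 1) U\<^bsup>l\<^esup> (b\<^sub>t + (b U)\<^sub>x) - l U\<^bsup>l+1\<^esup> (a\<^sub>t + b\<^sub>x)\<close>.  This is the required source
  once \<open>(j - 1) U M\<^bsub>j-2\<^esub> = (j - 1) a\<close>.  That holds trivially for \<open>j = 1\<close>.  For \<open>j \<ge> 3\<close> equality in
  the Hoelder inequality concentrates the distribution on \<open>{0, U}\<close>, where \<open>v\<^bsup>j-1\<^esup> = U v\<^bsup>j-2\<^esup>\<close>.\<close>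

section \<open>Fluid pairs as pairs of moment equations\<close>

text \<open>At \<open>m = 0\<close> the truncated index \<open>m - 1\<close> is harmless, since the
  factor \<open>real m\<close> vanishes; conservation of mass is thus included.\<close>

definition moment_law :: "ereal \<Rightarrow> (nat \<Rightarrow> txfun) \<Rightarrow> txfun \<Rightarrow> nat \<Rightarrow> bool" where
  "moment_law T M E m \<longleftrightarrow>
    balance_law T (M m) (M (m + 1)) (\<lambda>t x. - real m * E t x * M (m - 1) t x)"

text \<open>Only values at times in \<open>time_dom T\<close> enter a balance law, so identities
  that divide by moments are needed only where these are known to be nonzero.\<close>

lemma balance_law_cong:
  assumes "\<And>t x. t \<in> time_dom T \<Longrightarrow> q t x = q' t x"
    and "\<And>t x. t \<in> time_dom T \<Longrightarrow> f t x = f' t x"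
    and "\<And>t x. t \<in> time_dom T \<Longrightarrow> g t x = g' t x"
  shows "balance_law T q f g \<longleftrightarrow> balance_law T q' f' g'"
proof -
  have "((\<lambda>s. q s x) has_real_derivative d) (at t within time_dom T) \<longleftrightarrow>
      ((\<lambda>s. q' s x) has_real_derivative d) (at t within time_dom T)"
    if "t \<in> time_dom T" for t x d
    by (rule has_field_derivative_cong_eventually)
      (use that assms(1) in \<open>auto simp: eventually_at_filter\<close>)
  moreover have "(\<lambda>y. f t y) = (\<lambda>y. f' t y)" if "t \<in> time_dom T" for t
    using assms(2) that by auto
  ultimately show ?thesis
    unfolding balance_law_def using assms(3) by (intro ball_cong refl) simp
qed

lemma fluid_pair_iff_moment_laws:
  assumes i: "i \<ge> 1"
    and nz: "\<forall>t\<in>time_dom T. \<forall>x. M (2 * i - 2) t x \<noteq> 0"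
    and nz': "i \<noteq> 1 \<Longrightarrow> \<forall>t\<in>time_dom T. \<forall>x. M (2 * (i - 1) - 2) t x \<noteq> 0"
  shows "fluid_pair T i M E \<longleftrightarrow> moment_law T M E (2 * i - 2) \<and> moment_law T M E (2 * i - 1)"
proof -
  have idx: "2 * i - 2 + 1 = 2 * i - 1" "2 * i - 1 + 1 = 2 * i" "2 * i - 1 - 1 = 2 * i - 2"
    "2 * (i - 1) - 1 = 2 * i - 2 - 1" "2 * (i + 1) - 2 = 2 * i"
    "real (2 * i - 2) = 2 * real i - 2" "real (2 * i - 1) = 2 * real i - 1"
    using i by (auto simp: of_nat_diff)
  have flux: "fluid_n M i t x * fluid_U M i t x = M (2 * i - 1) t x"
    if "t \<in> time_dom T" for t x
    using nz that by (simp add: fluid_n_def fluid_U_def)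
  \<comment> \<open>For \<open>i = 1\<close> there is no preceding fluid; the source is then 0 on
    both sides.\<close>
  have prev: "fluid_n M (i - 1) t x * fluid_U M (i - 1) t x = M (2 * i - 2 - 1) t x"
    if "t \<in> time_dom T" "i \<noteq> 1" for t x
    using nz' that unfolding fluid_n_def fluid_U_def idx(4) by simp
  have "balance_law T (fluid_n M i) (\<lambda>t x. fluid_n M i t x * fluid_U M i t x)
      (\<lambda>t x. if i = 1 then 0
         else - (2 * real i - 2) * E t x * (fluid_n M (i - 1) t x * fluid_U M (i - 1) t x))
    \<longleftrightarrow> moment_law T M E (2 * i - 2)"
    unfolding moment_law_def idx
    by (rule balance_law_cong) (use flux prev in \<open>auto simp: fluid_n_def\<close>)
  moreover have "balance_law T (\<lambda>t x. fluid_n M i t x * fluid_U M i t x)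
      (\<lambda>t x. fluid_n M i t x * (fluid_U M i t x)\<^sup>2 + fluid_P M i t x)
      (\<lambda>t x. - (2 * real i - 1) * E t x * fluid_n M i t x)
    \<longleftrightarrow> moment_law T M E (2 * i - 1)"
    unfolding moment_law_def idx
    by (rule balance_law_cong) (use flux idx(5) in \<open>auto simp: fluid_n_def fluid_P_def\<close>)
  ultimately show ?thesis
    unfolding fluid_pair_def by simp
qed

text \<open>The closure turns the exceptional last flux into the next moment, so the last equation
  gets the shape of the others.\<close>

lemma closed_moment_system_iff_moment_laws:
  assumes k: "k \<ge> 1"
    and nz: "\<forall>t\<in>time_dom T. \<forall>x. M (2 * k - 2) t x \<noteq> 0"
    and cl: "closure_principle T k M"
  shows "closed_moment_system T (2 * k - 1) M E \<longleftrightarrow>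
    (\<forall>m<2 * k. moment_law T M E m) \<and> field_equation T (\<lambda>t x. M 1 t x / M 0 t x) E"
proof -
  have idx: "2 * k - 1 - 1 = 2 * k - 2" "2 * k - 1 + 1 = 2 * k"
    using k by auto
  have first: "balance_law T (M 0) (M 1) (\<lambda>t x. 0) \<longleftrightarrow> moment_law T M E 0"
    by (simp add: moment_law_def)
  have last: "balance_law T (M (2 * k - 1)) (\<lambda>t x. (M (2 * k - 1) t x)\<^sup>2 / M (2 * k - 2) t x)
      (\<lambda>t x. - real (2 * k - 1) * E t x * M (2 * k - 2) t x) \<longleftrightarrow> moment_law T M E (2 * k - 1)"
    unfolding moment_law_def idx
    by (rule balance_law_cong) (use nz cl in \<open>auto simp: closure_principle_def\<close>)
  have "m < 2 * k \<longleftrightarrow> m = 0 \<or> (1 \<le> m \<and> m \<le> 2 * k - 2) \<or> m = 2 * k - 1" for m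
    using k by auto
  then show ?thesis
    unfolding closed_moment_system_def idx first last moment_law_def[symmetric] by auto
qed

lemma closure_iff_fluid_P_eq_0:
  assumes "M (2 * k - 2) t x \<noteq> 0"
  shows "(M (2 * k - 1) t x)\<^sup>2 = M (2 * k) t x * M (2 * k - 2) t x \<longleftrightarrow> fluid_P M k t x = 0"
  using assms
  by (simp add: fluid_P_def fluid_n_def fluid_U_def power2_eq_square divide_simps mult.commute) auto

section \<open>Equality case of the Hoelder inequality\<close>

text \<open>The hypothesis is the equality case of the Hoelder inequality; it forces \<open>v \<in> {0, u}\<close> almost
  everywhere.\<close>

lemma moments_geometric_below:
  fixes N :: "real measure" and p :: nat
  assumes int: "\<And>i. integrable N (\<lambda>v. v ^ i)"
    and p: "even p" "p \<ge> 2"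
    and nz: "(\<integral>v. v ^ p \<partial>N) \<noteq> 0"
    and eq: "(\<integral>v. v ^ (p + 1) \<partial>N)\<^sup>2 = (\<integral>v. v ^ (p + 2) \<partial>N) * (\<integral>v. v ^ p \<partial>N)"
  shows "(\<integral>v. v ^ (p - 1) \<partial>N) * (\<integral>v. v ^ (p + 1) \<partial>N) = (\<integral>v. v ^ p \<partial>N)\<^sup>2"
proof -
  define m where "m i = (\<integral>v. v ^ i \<partial>N)" for i
  \<comment> \<open>This \<open>u\<close> minimises
    \<open>m (p + 2) - 2 * u * m (p + 1) + u\<^sup>2 * m p\<close>, the integral of the nonnegative
    \<open>v ^ p * (v - u)\<^sup>2\<close>; by \<open>eq\<close> the minimum is 0.\<close>
  define u where "u = m (p + 1) / m p"
  note nz = nz[folded m_def] and eq = eq[folded m_def]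
  have expand: "v ^ p * (v - u)\<^sup>2 = v ^ (p + 2) - 2 * u * v ^ (p + 1) + u\<^sup>2 * v ^ p" for v :: real
    by (simp add: power2_eq_square algebra_simps)
  have int': "integrable N (\<lambda>v. v ^ p * (v - u)\<^sup>2)"
    unfolding expand by (intro Bochner_Integration.integrable_add Bochner_Integration.integrable_diff
        integrable_mult_right int)
  have "(\<integral>v. v ^ p * (v - u)\<^sup>2 \<partial>N) = m (p + 2) - 2 * u * m (p + 1) + u\<^sup>2 * m p"
    unfolding expand using int[of p] int[of "p + 1"] int[of "p + 2"] by (simp add: m_def)
  also have "\<dots> = 0"
    using nz eq by (simp add: u_def field_simps power2_eq_square)
  finally have "AE v in N. v ^ p * (v - u)\<^sup>2 = 0"
    using integral_nonneg_eq_0_iff_AE[OF int'] p(1) by (simp add: zero_le_even_power)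
  \<comment> \<open>At \<open>v = 0\<close> both sides vanish because \<open>p \<ge> 2\<close>
    leaves a positive exponent \<open>p - 1\<close>.\<close>
  then have "AE v in N. v ^ p = u * v ^ (p - 1)"
  proof (rule AE_mp, intro AE_I2 impI)
    fix v :: real
    assume "v ^ p * (v - u)\<^sup>2 = 0"
    then have "v = 0 \<or> v = u" by auto
    then show "v ^ p = u * v ^ (p - 1)"
      using p(2) by (cases p) auto
  qed
  then have "m p = (\<integral>v. u * v ^ (p - 1) \<partial>N)"
    unfolding m_def
    by (intro integral_cong_AE) (use int in \<open>auto intro: borel_measurable_integrable\<close>)
  then have "m p = u * m (p - 1)"
    by (simp add: m_def)
  then have "m (p - 1) * m (p + 1) = (m p)\<^sup>2"
    using nz by (simp add: u_def field_simps power2_eq_square)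
  then show ?thesis
    by (simp add: m_def)
qed

section \<open>Moment equations above the closure\<close>

text \<open>The function is \<open>a * U ^ (l + 1)\<close> with \<open>U = b / a\<close>. A general
  \<open>S\<close> covers both the time derivative within \<open>time_dom T\<close> and the space
  derivative.\<close>

lemma has_real_derivative_geometric:
  fixes a b :: "real \<Rightarrow> real"
  assumes a: "(a has_real_derivative a') (at x within S)"
    and b: "(b has_real_derivative b') (at x within S)"
    and nz: "a x \<noteq> 0"
  shows "((\<lambda>y. b y ^ (l + 1) / a y ^ l) has_real_derivative
    (real l + 1) * (b x / a x) ^ l * b' - real l * (b x / a x) ^ (l + 1) * a') (at x within S)"
proof -
  define U where "U = b x / a x"
  have bx: "b x = U * a x"
    using nz by (simp add: U_def)
  have deriv: "((\<lambda>y. b y ^ (l + 1) / a y ^ l) has_real_derivative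
      (real (l + 1) * (b' * b x ^ l) * a x ^ l - b x ^ (l + 1) * (real l * (a' * a x ^ (l - 1)))) /
        (a x ^ l * a x ^ l)) (at x within S)"
    using DERIV_divide[OF DERIV_power[OF b, of "l + 1"] DERIV_power[OF a, of l]] nz by simp
  moreover have "(real (l + 1) * (b' * b x ^ l) * a x ^ l
        - b x ^ (l + 1) * (real l * (a' * a x ^ (l - 1)))) / (a x ^ l * a x ^ l)
      = (real l + 1) * U ^ l * b' - real l * U ^ (l + 1) * a'"
    unfolding bx power_mult_distrib using nz by (cases l) (simp_all add: field_simps)
  ultimately show ?thesis
    unfolding U_def[symmetric] by (rule DERIV_cong)
qed

text \<open>The source in \<open>below\<close> contains \<open>M (j - 2)\<close>;
  \<open>geom\<close> continues the geometric progression of the moments down to it.\<close>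

lemma moment_law_above_closure:
  assumes j: "j \<ge> 1" and l: "l \<ge> 1"
    and nz: "\<forall>t\<in>time_dom T. \<forall>x. M (j - 1) t x \<noteq> 0 \<and> M j t x \<noteq> 0"
    and below: "moment_law T M E (j - 1)"
    and at: "moment_law T M E j"
    and higher: "higher_moments_closed T j M"
    and geom: "\<forall>t\<in>time_dom T. \<forall>x. j > 1 \<longrightarrow> M (j - 2) t x * M j t x = (M (j - 1) t x)\<^sup>2"
  shows "moment_law T M E (j + l)"
proof -
  have high: "M (j + i) t x = M j t x ^ (i + 1) / M (j - 1) t x ^ i"
    if "t \<in> time_dom T" for i t x
    using higher that by (auto simp: higher_moments_closed_def)
  have "balance_law T (\<lambda>t x. M j t x ^ (l + 1) / M (j - 1) t x ^ l)
     (\<lambda>t x. M j t x ^ ((l + 1) + 1) / M (j - 1) t x ^ (l + 1))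
     (\<lambda>t x. - real (j + l) * E t x * (M j t x ^ l / M (j - 1) t x ^ (l - 1)))"
    unfolding balance_law_def
  proof (intro ballI allI)
    fix t x
    assume t: "t \<in> time_dom T"
    define a where "a = M (j - 1) t x"
    define b where "b = M j t x"
    define U where "U = b / a"
    have a0: "a \<noteq> 0" and b0: "b \<noteq> 0"
      using nz t by (auto simp: a_def b_def)
    obtain a_t b_x where
      a_t: "((\<lambda>s. M (j - 1) s x) has_real_derivative a_t) (at t within time_dom T)"
      and b_x: "((\<lambda>y. M j t y) has_real_derivative b_x) (at x)"
      and eq1: "a_t + b_x = - real (j - 1) * E t x * M (j - 1 - 1) t x"
      using below t j unfolding moment_law_def balance_law_def by fastforce
    obtain b_t g_x where
      b_t: "((\<lambda>s. M j s x) has_real_derivative b_t) (at t within time_dom T)"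
      and g_x: "((\<lambda>y. M (j + 1) t y) has_real_derivative g_x) (at x)"
      and eq2: "b_t + g_x = - real j * E t x * a"
      using at t unfolding moment_law_def balance_law_def a_def by fastforce
    have g_eq: "M (j + 1) t y = (M j t y)\<^sup>2 / M (j - 1) t y" for y
      using high[OF t, of 1 y] by (simp add: power2_eq_square)
    have nz_t: "M (j - 1) t y \<noteq> 0" "M j t y \<noteq> 0" for y
      using nz t by auto
    txt \<open>For \<open>j = 1\<close> no equation of the system contains \<open>a\<^sub>x\<close>; it exists because \<open>a = b\<^sup>2 / M\<^bsub>j+1\<^esub>\<close>
      with \<open>M\<^bsub>j+1\<^esub> \<noteq> 0\<close>.\<close>
    have a_eq: "(\<lambda>y. M (j - 1) t y) = (\<lambda>y. (M j t y)\<^sup>2 / M (j + 1) t y)"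
      using nz_t unfolding g_eq by (auto simp: fun_eq_iff)
    have "(\<lambda>y. (M j t y)\<^sup>2 / M (j + 1) t y) differentiable (at x)"
      using b_x g_x nz_t g_eq
      by (intro differentiable_divide differentiable_power)
        (auto simp: real_differentiable_def)
    then obtain a_x where a_x: "((\<lambda>y. M (j - 1) t y) has_real_derivative a_x) (at x)"
      unfolding a_eq[symmetric] by (auto simp: real_differentiable_def)
    \<comment> \<open>The flux in \<open>at\<close> is the case \<open>l = 1\<close> of the
      geometric formula, so uniqueness of derivatives determines \<open>g_x\<close>.\<close>
    have "((\<lambda>y. M (j + 1) t y) has_real_derivative 2 * U * b_x - U\<^sup>2 * a_x) (at x)"
      using has_real_derivative_geometric[OF a_x b_x, of 1] a0
      unfolding g_eq by (simp add: a_def b_def U_def power2_eq_square)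
    then have g_x_eq: "g_x = 2 * U * b_x - U\<^sup>2 * a_x"
      using g_x DERIV_unique by blast
    have q_t: "((\<lambda>s. M j s x ^ (l + 1) / M (j - 1) s x ^ l) has_real_derivative
        (real l + 1) * U ^ l * b_t - real l * U ^ (l + 1) * a_t) (at t within time_dom T)"
      using has_real_derivative_geometric[OF a_t b_t] a0 by (simp add: a_def b_def U_def)
    have f_x: "((\<lambda>y. M j t y ^ ((l + 1) + 1) / M (j - 1) t y ^ (l + 1)) has_real_derivative
        (real l + 2) * U ^ (l + 1) * b_x - (real l + 1) * U ^ (l + 2) * a_x) (at x)"
      using has_real_derivative_geometric[OF a_x b_x, of "l + 1"] a0
      by (simp add: a_def b_def U_def add.commute)
    have source: "real (j - 1) * (U * M (j - 1 - 1) t x) = real (j - 1) * a"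
    proof (cases "j > 1")
      case True
      then have "M (j - 1 - 1) t x * b = a * a"
        using geom t by (simp add: a_def b_def power2_eq_square numeral_2_eq_2)
      then show ?thesis using a0 by (simp add: U_def field_simps)
    qed (use j in simp)
    \<comment> \<open>The terms in \<open>b_x\<close> match because
      \<open>2 * (l + 1) - l = l + 2\<close>.\<close>
    have "((real l + 1) * U ^ l * b_t - real l * U ^ (l + 1) * a_t)
        + ((real l + 2) * U ^ (l + 1) * b_x - (real l + 1) * U ^ (l + 2) * a_x)
      = (real l + 1) * U ^ l * (b_t + g_x) - real l * U ^ l * (U * (a_t + b_x))"
      unfolding g_x_eq by (simp add: algebra_simps power2_eq_square)
    also have "U * (a_t + b_x) = - E t x * (real (j - 1) * (U * M (j - 1 - 1) t x))"
      unfolding eq1 by (simp add: algebra_simps)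
    also have "\<dots> = - E t x * (real (j - 1) * a)"
      unfolding source ..
    \<comment> \<open>The source coefficients combine as
      \<open>(l + 1) * j - l * (j - 1) = j + l\<close>.\<close>
    also have "(real l + 1) * U ^ l * (b_t + g_x) - real l * U ^ l * (- E t x * (real (j - 1) * a))
      = - real (j + l) * E t x * (a * U ^ l)"
      unfolding eq2 using j by (simp add: of_nat_diff algebra_simps)
    also have "a * U ^ l = b ^ l / a ^ (l - 1)"
      using l a0 by (cases l) (simp_all add: U_def power_divide)
    finally show "\<exists>q_t f_x.
       ((\<lambda>s. M j s x ^ (l + 1) / M (j - 1) s x ^ l) has_real_derivative q_t)
         (at t within time_dom T) \<and>
       ((\<lambda>y. M j t y ^ ((l + 1) + 1) / M (j - 1) t y ^ (l + 1)) has_real_derivative f_x) (at x) \<and>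
       q_t + f_x = - real (j + l) * E t x * (M j t x ^ l / M (j - 1) t x ^ (l - 1))"
      using q_t f_x unfolding a_def b_def by blast
  qed
  \<comment> \<open>Since \<open>l \<ge> 1\<close>, the moment \<open>M (j + l - 1)\<close> in the
    source is also given by the geometric formula.\<close>
  moreover have "j + l - 1 = j + (l - 1)" "l - 1 + 1 = l" "j + l + 1 = j + (l + 1)"
    using l by auto
  ultimately show ?thesis
    unfolding moment_law_def
    by (subst balance_law_cong[where q' = "\<lambda>t x. M j t x ^ (l + 1) / M (j - 1) t x ^ l"
          and f' = "\<lambda>t x. M j t x ^ ((l + 1) + 1) / M (j - 1) t x ^ (l + 1)"
          and g' = "\<lambda>t x. - real (j + l) * E t x * (M j t x ^ l / M (j - 1) t x ^ (l - 1))"])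
      (simp_all only: high)
qed

section \<open>Equivalence with the fluid system and the fluids beyond step \<open>k\<close>\<close>

theorem theorem3p1:
  fixes T :: ereal and k :: nat
    and M :: "nat \<Rightarrow> real \<Rightarrow> real \<Rightarrow> real" and E :: "real \<Rightarrow> real \<Rightarrow> real"
    and F :: "real \<Rightarrow> real \<Rightarrow> real measure"
  assumes "T > 0" and "k \<ge> 1"
    and "\<forall>i\<in>{1..k}. \<forall>t\<in>time_dom T. \<forall>x. M (2 * i - 2) t x \<noteq> 0"
  shows
    "(closed_moment_system T (2 * k - 1) M E \<and> closure_principle T k M \<longleftrightarrow> MF_system T k M E) \<and>
     (\<forall>t\<in>time_dom T. \<forall>x.
        (M (2 * k - 1) t x)\<^sup>2 = M (2 * k) t x * M (2 * k - 2) t x \<longleftrightarrow> fluid_P M k t x = 0) \<and>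
     (moments_of T F M \<and>
      (\<forall>i>k. \<forall>t\<in>time_dom T. \<forall>x. M (2 * i - 2) t x \<noteq> 0) \<and>
      closed_moment_system T (2 * k - 1) M E \<and> higher_moments_closed T (2 * k - 1) M \<and>
      (\<forall>i>k. P_vanishes T i M)
      \<longrightarrow> (\<forall>i>k. fluid_pair T i M E))"
proof (intro conjI impI allI ballI)
  have nz: "\<forall>t\<in>time_dom T. \<forall>x. M (2 * i - 2) t x \<noteq> 0" if "1 \<le> i" "i \<le> k" for i
    using assms(3) that by simp
  have nz_k: "\<forall>t\<in>time_dom T. \<forall>x. M (2 * k - 2) t x \<noteq> 0"
    using nz assms(2) by simp
  show P: "(M (2 * k - 1) t x)\<^sup>2 = M (2 * k) t x * M (2 * k - 2) t x \<longleftrightarrow> fluid_P M k t x = 0"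
    if "t \<in> time_dom T" for t x
    using closure_iff_fluid_P_eq_0 nz_k that by blast
  have closure: "closure_principle T k M \<longleftrightarrow> P_vanishes T k M"
    using P by (simp add: closure_principle_def P_vanishes_def)
  have "(\<forall>i\<in>{1..k}. fluid_pair T i M E) \<longleftrightarrow>
      (\<forall>i\<in>{1..k}. moment_law T M E (2 * i - 2) \<and> moment_law T M E (2 * i - 1))"
    by (intro ball_cong refl fluid_pair_iff_moment_laws nz) auto
  also have "\<dots> \<longleftrightarrow> (\<forall>m<2 * k. moment_law T M E m)" (is "?L \<longleftrightarrow> ?R")
  proof
    assume L: ?L
    show ?R
    proof (intro allI impI)
      fix m
      assume "m < 2 * k"
      then have "m div 2 + 1 \<in> {1..k}" by auto
      with L have "moment_law T M E (2 * (m div 2 + 1) - 2)"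
        "moment_law T M E (2 * (m div 2 + 1) - 1)" by blast+
      moreover have "m = 2 * (m div 2 + 1) - 2 \<or> m = 2 * (m div 2 + 1) - 1"
        by presburger
      ultimately show "moment_law T M E m" by metis
    qed
  qed auto
  finally have pairs: "(\<forall>i\<in>{1..k}. fluid_pair T i M E) \<longleftrightarrow> (\<forall>m<2 * k. moment_law T M E m)" .
  have "fluid_U M 1 = (\<lambda>t x. M 1 t x / M 0 t x)"
    by (simp add: fluid_U_def fun_eq_iff)
  then show "closed_moment_system T (2 * k - 1) M E \<and> closure_principle T k M \<longleftrightarrow>
      MF_system T k M E"
    unfolding MF_system_def closure[symmetric] pairs
    using closed_moment_system_iff_moment_laws[where k = k and M = M, OF assms(2) nz_k] by auto

  fix i
  assume hyp: "moments_of T F M \<and>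
      (\<forall>i>k. \<forall>t\<in>time_dom T. \<forall>x. M (2 * i - 2) t x \<noteq> 0) \<and>
      closed_moment_system T (2 * k - 1) M E \<and> higher_moments_closed T (2 * k - 1) M \<and>
      (\<forall>i>k. P_vanishes T i M)"
    and i: "k < i"
  have nz_high: "\<forall>t\<in>time_dom T. \<forall>x. M (2 * i - 2) t x \<noteq> 0" if "i > k" for i
    using hyp that by blast
  have nz_all: "\<forall>t\<in>time_dom T. \<forall>x. M (2 * i - 2) t x \<noteq> 0" if "i \<ge> 1" for i
    using nz nz_high that by (meson not_le)
  have idx: "2 * k - 1 + 1 = 2 * k" "2 * k - 1 - 1 = 2 * k - 2"
    using assms(2) by auto
  \<comment> \<open>The case \<open>i = 1\<close> of the continuation formula is the closure
    itself.\<close>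
  have M_2k: "M (2 * k) t x = (M (2 * k - 1) t x)\<^sup>2 / M (2 * k - 2) t x"
    if "t \<in> time_dom T" for t x
  proof -
    have "M (2 * k - 1 + 1) t x = M (2 * k - 1) t x ^ (1 + 1) / M (2 * k - 1 - 1) t x ^ 1"
      using hyp that unfolding higher_moments_closed_def by blast
    then show ?thesis
      unfolding idx by (simp add: numeral_2_eq_2)
  qed
  then have cl: "closure_principle T k M"
    using nz_k by (simp add: closure_principle_def)
  then have laws: "\<forall>m<2 * k. moment_law T M E m"
    using closed_moment_system_iff_moment_laws[where k = k and M = M, OF assms(2) nz_k] hyp by blast
  \<comment> \<open>The odd moment \<open>M (2 * k - 1)\<close> cannot vanish, because its square is
    a factor of the nonzero density \<open>M (2 * k)\<close> of fluid \<open>k + 1\<close>.\<close>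
  have nz_j: "\<forall>t\<in>time_dom T. \<forall>x. M (2 * k - 1 - 1) t x \<noteq> 0 \<and> M (2 * k - 1) t x \<noteq> 0"
  proof (intro ballI allI)
    fix t x
    assume t: "t \<in> time_dom T"
    have "M (2 * k) t x \<noteq> 0"
      using nz_high[of "k + 1"] t by simp
    then show "M (2 * k - 1 - 1) t x \<noteq> 0 \<and> M (2 * k - 1) t x \<noteq> 0"
      using M_2k[OF t] nz_k t unfolding idx by auto
  qed
  \<comment> \<open>This concerns a moment below the closure, which the continuation formula does
    not reach; the measure \<open>F t x\<close> supplies the identity.\<close>
  have geom: "\<forall>t\<in>time_dom T. \<forall>x. 2 * k - 1 > 1 \<longrightarrow>
      M (2 * k - 1 - 2) t x * M (2 * k - 1) t x = (M (2 * k - 1 - 1) t x)\<^sup>2"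
  proof (intro ballI allI impI)
    fix t x
    assume t: "t \<in> time_dom T" and k: "2 * k - 1 > 1"
    define p where "p = 2 * k - 2"
    have p: "even p" "p \<ge> 2" "p + 1 - 2 = p - 1" "p + 1 - 1 = p"
      "2 * k - 1 = p + 1" "2 * k = p + 2"
      using k unfolding p_def by presburger+
    have int: "integrable (F t x) (\<lambda>v. v ^ i)" and mom: "M i t x = (\<integral>v. v ^ i \<partial>F t x)" for i
      using hyp t by (auto simp: moments_of_def)
    have "M (2 * k - 2) t x \<noteq> 0"
      "(M (2 * k - 1) t x)\<^sup>2 = M (2 * k) t x * M (2 * k - 2) t x"
      using nz_k cl t by (auto simp: closure_principle_def)
    then have "M p t x \<noteq> 0" "(M (p + 1) t x)\<^sup>2 = M (p + 2) t x * M p t x"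
      unfolding p(5,6)[symmetric] by (simp_all add: p_def)
    then show "M (2 * k - 1 - 2) t x * M (2 * k - 1) t x = (M (2 * k - 1 - 1) t x)\<^sup>2"
      using moments_geometric_below[OF int p(1,2)] unfolding p(3-5) mom by blast
  qed
  have law: "moment_law T M E m" if "m \<ge> 2 * k" for m
  proof -
    have "moment_law T M E (2 * k - 1 + (m - (2 * k - 1)))"
    proof (rule moment_law_above_closure[OF _ _ nz_j _ _ _ geom])
      show "moment_law T M E (2 * k - 1 - 1)" "moment_law T M E (2 * k - 1)"
        using laws assms(2) by auto
      show "higher_moments_closed T (2 * k - 1) M"
        using hyp by blast
    qed (use assms(2) that in auto)
    then show ?thesis using that by simp
  qed
  show "fluid_pair T i M E"
  proof (rule fluid_pair_iff_moment_laws[THEN iffD2])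
    show "moment_law T M E (2 * i - 2) \<and> moment_law T M E (2 * i - 1)"
      using law i by auto
  qed (use nz_all i assms(2) in auto)
qed

end
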